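(* Let $\alpha>0$. Suppose that the weighted multigraph $G'$ differs from the weighted multigraph $G$ in a $(k,t)$ edge only, with $\Delta\varepsilon_{kt}=\varepsilon\ne 0$, and put $\Delta d_{ij}=d'_{ij}-d_{ij}$ and $\Delta q_{ij}=q'_{ij}-q_{ij}$. Then the following equalities hold for all $i,j=1,\ldots,n$: $$\Delta q_{ij}=-\alpha\varepsilon\,\pi_{i(kt)}\pi_{j(kt)}\frac{d'_{kt}}{d_{kt}}=-\alpha\varepsilon\,\pi'_{i(kt)}\pi'_{j(kt)}\frac{d_{kt}}{d'_{kt}},$$ $$2\Delta d_{ij}=-\alpha\varepsilon(\tau_{i(kt)}-\tau_{j(kt)})^2\frac{d'_{kt}}{d_{kt}}=-\alpha\varepsilon(\tau'_{i(kt)}-\tau'_{j(kt)})^2\frac{d_{kt}}{d'_{kt}}$$ $$\phantom{2\Delta d_{ij}}=-\alpha\varepsilon(\pi_{i(kt)}-\pi_{j(kt)})^2\frac{d'_{kt}}{d_{kt}}=-\alpha\varepsilon(\pi'_{i(kt)}-\pi'_{j(kt)})^2\frac{d_{kt}}{d'_{kt}}.$$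
   Context: A weighted multigraph $G$ has finite vertex set $V(G)=\{1,\ldots,n\}$; multiple edges are allowed, loops are not, and all edge weights are strictly positive. Its Laplacian matrix $L=L(G)=(\ell_{ij})$ is given by: for $j\ne i$, $\ell_{ij}$ is minus the sum of the weights of all edges with terminal vertices $i$ and $j$; and $\ell_{ii}=-\sum_{j\neq i}\ell_{ij}$. For a fixed parameter $\alpha>0$, the relative forest accessibility matrix is $Q=(q_{ij})=(I+\alpha L)^{-1}$, and the forest distance is $d_{ij}=\frac12(q_{ii}+q_{jj}-q_{ij}-q_{ji})$ (this is a metric on $V(G)$). For vertices $i,k,t$, put $\tau_{i(kt)}=d_{ik}-d_{it}$ and $\pi_{i(kt)}=q_{ik}-q_{it}$. For $k\neq t$, a weighted multigraph $G'$ (on the same vertex set) differs from $G$ in a $(k,t)$ edge only, with $\Delta\varepsilon_{kt}=\varepsilon\neq0$, if $G'$ is obtained from $G$ by increasing the weight of some edge between $k$ and $t$ by $\varepsilon$, or by adding a new edge between $k$ and $t$ with weight $\varepsilon$ (when $\varepsilon>0$), or by removing an edge between $k$ and $t$ with weight $-\varepsilon$ (when $\varepsilon<0$). Unprimed quantities refer to $G$ and primed quantities refer to $G'$, with the same $\alpha$. *)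

theory Defs
  imports "HOL-Analysis.Analysis" "HOL-Library.Multiset"
begin

text \<open>
  A weighted multigraph on the vertex set \<open>'n\<close> is the finite multiset of its edges; an edge is the
  set of its two end vertices together with its weight.
\<close>

type_synonym 'n wmgraph = "('n set \<times> real) multiset"

definition weighted_multigraph :: "'n wmgraph \<Rightarrow> bool" where
  "weighted_multigraph G \<longleftrightarrow> (\<forall>(e, w) \<in> set_mset G. card e = 2 \<and> 0 < w)"

definition total_weight :: "'n wmgraph \<Rightarrow> 'n \<Rightarrow> 'n \<Rightarrow> real" where
  "total_weight G i j = \<Sum>\<^sub># (image_mset snd (filter_mset (\<lambda>x. fst x = {i, j}) G))"

definition laplacian :: "'n::finite wmgraph \<Rightarrow> real ^ 'n ^ 'n" where
  "laplacian G = (\<chi> i j. if j \<noteq> i then - total_weight G i j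
                          else - (\<Sum>m \<in> UNIV - {i}. - total_weight G i m))"

definition acc_matrix :: "real \<Rightarrow> 'n::finite wmgraph \<Rightarrow> real ^ 'n ^ 'n" where
  "acc_matrix \<alpha> G = matrix_inv (mat 1 + \<alpha> *\<^sub>R laplacian G)"

definition acc :: "real \<Rightarrow> 'n::finite wmgraph \<Rightarrow> 'n \<Rightarrow> 'n \<Rightarrow> real" where
  "acc \<alpha> G i j = acc_matrix \<alpha> G $ i $ j"

definition forest_dist :: "real \<Rightarrow> 'n::finite wmgraph \<Rightarrow> 'n \<Rightarrow> 'n \<Rightarrow> real" where
  "forest_dist \<alpha> G i j = (acc \<alpha> G i i + acc \<alpha> G j j - acc \<alpha> G i j - acc \<alpha> G j i) / 2"

definition tau :: "real \<Rightarrow> 'n::finite wmgraph \<Rightarrow> 'n \<Rightarrow> 'n \<Rightarrow> 'n \<Rightarrow> real" where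
  "tau \<alpha> G i k t = forest_dist \<alpha> G i k - forest_dist \<alpha> G i t"

definition pi_diff :: "real \<Rightarrow> 'n::finite wmgraph \<Rightarrow> 'n \<Rightarrow> 'n \<Rightarrow> 'n \<Rightarrow> real" where
  "pi_diff \<alpha> G i k t = acc \<alpha> G i k - acc \<alpha> G i t"

text \<open>
  In the first case \<open>\<epsilon>\<close> may be negative (a decrease of the weight); positivity of the new weight
  is then expressed by \<open>weighted_multigraph G'\<close>.
\<close>

definition differs_in_edge :: "'n wmgraph \<Rightarrow> 'n wmgraph \<Rightarrow> 'n \<Rightarrow> 'n \<Rightarrow> real \<Rightarrow> bool" where
  "differs_in_edge G G' k t \<epsilon> \<longleftrightarrow>
     (\<exists>w. ({k, t}, w) \<in># G \<and> G' = add_mset ({k, t}, w + \<epsilon>) (G - {#({k, t}, w)#})) \<or>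
     (\<epsilon> > 0 \<and> G' = add_mset ({k, t}, \<epsilon>) G) \<or>
     (\<epsilon> < 0 \<and> ({k, t}, - \<epsilon>) \<in># G \<and> G' = G - {#({k, t}, - \<epsilon>)#})"

end

theory Submission imports Defs begin

text \<open>
  With \<open>v = e\<^sub>k - e\<^sub>t\<close>, the Laplacian changes by the rank-one matrix \<open>\<epsilon> v v\<^sup>T\<close>. Hence
  \<open>Q - Q' = Q (M' - M) Q'\<close>, where \<open>M = I + \<alpha> L\<close>, reads \<open>\<Delta>q\<^sub>i\<^sub>j = - \<alpha> \<epsilon> \<pi>\<^sub>i \<pi>'\<^sub>j\<close>. Taking differences in
  \<open>j\<close>, and then in \<open>i\<close>, gives \<open>\<pi>'\<^sub>i = (1 - 2 \<alpha> \<epsilon> d'\<^sub>k\<^sub>t) \<pi>\<^sub>i\<close> and \<open>d'\<^sub>k\<^sub>t = (1 - 2 \<alpha> \<epsilon> d'\<^sub>k\<^sub>t) d\<^sub>k\<^sub>t\<close>; since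
  \<open>2 d\<^sub>k\<^sub>t = v\<^sup>T Q v > 0\<close>, this yields \<open>\<pi>'\<^sub>i = \<pi>\<^sub>i d'\<^sub>k\<^sub>t / d\<^sub>k\<^sub>t\<close>.
\<close>

lemma total_weight_commute: "total_weight G i j = total_weight G j i"
  by (simp add: total_weight_def insert_commute)

lemma total_weight_nonneg:
  assumes "weighted_multigraph G"
  shows "0 \<le> total_weight G i j"
proof -
  have "0 \<le> snd x" if "x \<in># G" for x
    using assms that unfolding weighted_multigraph_def by fastforce
  then show ?thesis
    unfolding total_weight_def by (induction G) auto
qed

text \<open>Zero row sums allow the diagonal entry to be spread over the differences
  \<open>x $ i - x $ j\<close>. The term \<open>j = i\<close> vanishes whatever
  \<open>total_weight G i i\<close> is, so the sum may run over all vertices.\<close>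

lemma laplacian_mult_component:
  "(laplacian G *v x) $ i = (\<Sum>j\<in>UNIV. total_weight G i j * (x $ i - x $ j))"
proof -
  let ?w = "total_weight G i"
  have "(laplacian G *v x) $ i
      = laplacian G $ i $ i * x $ i + (\<Sum>j\<in>UNIV - {i}. laplacian G $ i $ j * x $ j)"
    by (simp add: matrix_vector_mult_def sum.remove[of UNIV i])
  also have "\<dots> = (\<Sum>j\<in>UNIV - {i}. ?w j) * x $ i + (\<Sum>j\<in>UNIV - {i}. - ?w j * x $ j)"
    by (auto simp: laplacian_def sum_negf intro!: arg_cong2[where f = "(+)"] sum.cong)
  also have "\<dots> = (\<Sum>j\<in>UNIV - {i}. ?w j * (x $ i - x $ j))"
    by (simp add: sum_distrib_right right_diff_distrib sum_subtractf sum_negf)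
  also have "\<dots> = (\<Sum>j\<in>UNIV. ?w j * (x $ i - x $ j))"
    by (simp add: sum.remove[of UNIV i])
  finally show ?thesis .
qed

text \<open>Averaging the quadratic form with its copy under the swap of \<open>i\<close> and
  \<open>j\<close> turns it into half the sum of the terms
  \<open>total_weight G i j * (x $ i - x $ j)\<^sup>2\<close>.\<close>

lemma laplacian_nonneg:
  assumes "weighted_multigraph G"
  shows "0 \<le> x \<bullet> (laplacian G *v x)"
proof -
  let ?w = "total_weight G"
  have 1: "x \<bullet> (laplacian G *v x) = (\<Sum>i\<in>UNIV. \<Sum>j\<in>UNIV. ?w i j * (x $ i * (x $ i - x $ j)))"
    by (simp add: inner_vec_def laplacian_mult_component sum_distrib_left mult.left_commute)
  also have "\<dots> = (\<Sum>i\<in>UNIV. \<Sum>j\<in>UNIV. ?w i j * (x $ j * (x $ j - x $ i)))"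
    by (subst sum.swap) (simp add: total_weight_commute)
  finally have 2: "x \<bullet> (laplacian G *v x)
      = (\<Sum>i\<in>UNIV. \<Sum>j\<in>UNIV. ?w i j * (x $ j * (x $ j - x $ i)))" .
  have "2 * (x \<bullet> (laplacian G *v x))
      = (\<Sum>i\<in>UNIV. \<Sum>j\<in>UNIV. ?w i j * (x $ i * (x $ i - x $ j)))
        + (\<Sum>i\<in>UNIV. \<Sum>j\<in>UNIV. ?w i j * (x $ j * (x $ j - x $ i)))"
    using 1 2 by linarith
  also have "\<dots> = (\<Sum>i\<in>UNIV. \<Sum>j\<in>UNIV. ?w i j * (x $ i - x $ j)\<^sup>2)"
    unfolding sum.distrib[symmetric]
    by (intro sum.cong refl) (simp add: algebra_simps power2_eq_square)
  also have "0 \<le> \<dots>"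
    by (intro sum_nonneg mult_nonneg_nonneg total_weight_nonneg[OF assms]) auto
  finally show ?thesis by simp
qed

lemma transpose_laplacian: "transpose (laplacian G) = laplacian G"
  by (auto simp: laplacian_def transpose_def vec_eq_iff total_weight_commute)

definition acc_inverse :: "real \<Rightarrow> 'n::finite wmgraph \<Rightarrow> real ^ 'n ^ 'n" where
  "acc_inverse \<alpha> G = mat 1 + \<alpha> *\<^sub>R laplacian G"

lemma acc_inverse_mult:
  "acc_inverse \<alpha> G *v x = x + \<alpha> *\<^sub>R (laplacian G *v x)"
  by (simp add: acc_inverse_def matrix_vector_mult_add_rdistrib scaleR_matrix_vector_assoc)

lemma acc_inverse_positive:
  assumes "\<alpha> > 0" "weighted_multigraph G" "x \<noteq> 0"
  shows "0 < x \<bullet> (acc_inverse \<alpha> G *v x)"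
  using laplacian_nonneg[OF assms(2), of x] assms
  by (simp add: acc_inverse_mult inner_right_distrib add_pos_nonneg)

text \<open>Positive definiteness makes the kernel trivial, which suffices for a square
  matrix.\<close>

lemma invertible_acc_inverse:
  assumes "\<alpha> > 0" "weighted_multigraph G"
  shows "invertible (acc_inverse \<alpha> G)"
  unfolding invertible_left_inverse matrix_left_invertible_ker
  using acc_inverse_positive[OF assms] by (metis inner_zero_right less_irrefl)

text \<open>\<open>matrix_inv\<close> is a choice of a two-sided inverse; invertibility guarantees
  that the chosen matrix is one.\<close>

lemma
  assumes "\<alpha> > 0" "weighted_multigraph G"
  shows acc_matrix_right_inverse: "acc_inverse \<alpha> G ** acc_matrix \<alpha> G = mat 1"
    and acc_matrix_left_inverse: "acc_matrix \<alpha> G ** acc_inverse \<alpha> G = mat 1"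
  using someI_ex[OF invertible_acc_inverse[OF assms, unfolded invertible_def]]
  by (simp_all add: acc_matrix_def acc_inverse_def matrix_inv_def)

text \<open>Transposing \<open>M Q = I\<close> with \<open>M\<close> symmetric makes the transpose
  of \<open>Q\<close> a left inverse of \<open>M\<close>, and a left inverse equals the right
  inverse \<open>Q\<close>.\<close>

lemma acc_commute:
  assumes "\<alpha> > 0" "weighted_multigraph G"
  shows "acc \<alpha> G i j = acc \<alpha> G j i"
proof -
  let ?M = "acc_inverse \<alpha> G" and ?Q = "acc_matrix \<alpha> G"
  have "transpose ?M = ?M"
    using transpose_laplacian[of G]
    by (auto simp: acc_inverse_def transpose_def vec_eq_iff mat_def)
  then have "transpose ?Q ** ?M = mat 1"
    using acc_matrix_right_inverse[OF assms] by (metis matrix_transpose_mul transpose_mat)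
  then have "transpose ?Q = ?Q"
    using acc_matrix_right_inverse[OF assms]
    by (metis matrix_mul_assoc matrix_mul_lid matrix_mul_rid)
  then show ?thesis
    unfolding acc_def by (metis transpose_def vec_lambda_beta)
qed

lemma acc_matrix_mult_axis: "(acc_matrix \<alpha> G *v axis j 1) $ i = acc \<alpha> G i j"
  by (simp add: acc_def matrix_vector_mult_basis column_def)

lemma acc_matrix_mult_axis_diff:
  "(acc_matrix \<alpha> G *v (axis k 1 - axis t 1)) $ i = pi_diff \<alpha> G i k t"
  by (simp add: matrix_vector_mult_diff_distrib acc_matrix_mult_axis pi_diff_def)

lemma two_forest_dist:
  "2 * forest_dist \<alpha> G k t = pi_diff \<alpha> G k k t - pi_diff \<alpha> G t k t"
  by (simp add: forest_dist_def pi_diff_def)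

lemma forest_dist_positive:
  assumes "\<alpha> > 0" "weighted_multigraph G" "k \<noteq> t"
  shows "0 < forest_dist \<alpha> G k t"
proof -
  let ?v = "axis k 1 - axis t 1 :: real ^ 'a"
  \<comment> \<open>With \<open>y = Q v\<close>, the form \<open>v\<^sup>T Q v\<close> becomes
    \<open>y\<^sup>T M y\<close>, so positivity of \<open>M\<close> can be used directly;
    \<open>y\<close> is nonzero because \<open>M y = v\<close> is.\<close>
  define y where "y = acc_matrix \<alpha> G *v ?v"
  have My: "acc_inverse \<alpha> G *v y = ?v"
    using acc_matrix_right_inverse[OF assms(1,2)]
    by (simp add: y_def matrix_vector_mul_assoc)
  have "?v $ k \<noteq> 0" using assms(3) by (simp add: axis_def)
  then have "y \<noteq> 0" using My by (metis matrix_vector_mult_0_right zero_index)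
  then have "0 < y \<bullet> ?v"
    using acc_inverse_positive[OF assms(1,2)] My by metis
  also have "y \<bullet> ?v = 2 * forest_dist \<alpha> G k t"
    by (simp add: inner_diff_right inner_axis y_def acc_matrix_mult_axis_diff two_forest_dist)
  finally show ?thesis by simp
qed

text \<open>Symmetry of \<open>Q\<close> gives \<open>tau \<alpha> G i k t\<close> as half of
  \<open>q\<^sub>k\<^sub>k - q\<^sub>t\<^sub>t\<close>, which is free of \<open>i\<close>, minus
  \<open>pi_diff \<alpha> G i k t\<close>. The sign reversal disappears on squaring.\<close>

lemma tau_diff:
  assumes "\<alpha> > 0" "weighted_multigraph G"
  shows "tau \<alpha> G i k t - tau \<alpha> G j k t = pi_diff \<alpha> G j k t - pi_diff \<alpha> G i k t"
  using acc_commute[OF assms]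
  by (simp add: tau_def forest_dist_def pi_diff_def field_simps)

lemma differs_in_edge_total_weight:
  assumes "differs_in_edge G G' k t \<epsilon>"
  shows "total_weight G' i j = total_weight G i j + (if {i, j} = {k, t} then \<epsilon> else 0)"
proof -
  \<comment> \<open>Multiset difference is truncated, so the weight drops only if the edge occurs in
    \<open>G\<close>.\<close>
  have remove: "total_weight (G - {#(e, w)#}) i j = total_weight G i j - (if {i, j} = e then w else 0)"
    if mem: "(e, w) \<in># G" for e w
  proof -
    obtain H where "G = add_mset (e, w) H"
      using multi_member_split[OF mem] by blast
    then show ?thesis by (auto simp: total_weight_def)
  qed
  have add: "total_weight (add_mset (e, w) H) i j = total_weight H i j + (if {i, j} = e then w else 0)"
    for e w H
    by (auto simp: total_weight_def)
  show ?thesis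
    using assms unfolding differs_in_edge_def
    by (cases "{i, j} = {k, t}") (elim disjE exE conjE; simp add: add remove)+
qed

lemma differs_in_edge_laplacian_mult:
  assumes "differs_in_edge G G' k t \<epsilon>" "k \<noteq> t"
  shows "laplacian G' *v x
    = laplacian G *v x + (\<epsilon> * (x $ k - x $ t)) *\<^sub>R (axis k 1 - axis t 1)"
proof -
  have "(laplacian G' *v x) $ i
      = (laplacian G *v x + (\<epsilon> * (x $ k - x $ t)) *\<^sub>R (axis k 1 - axis t 1)) $ i" for i
  proof -
    have "(laplacian G' *v x) $ i - (laplacian G *v x) $ i
        = (\<Sum>j\<in>UNIV. (if {i, j} = {k, t} then \<epsilon> else 0) * (x $ i - x $ j))"
      by (simp add: laplacian_mult_component differs_in_edge_total_weight[OF assms(1)]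
          sum_subtractf[symmetric] algebra_simps)
    \<comment> \<open>The unordered condition splits into its two orientations, which exclude each
      other because \<open>k \<noteq> t\<close>; each leaves a single term of the sum.\<close>
    also have "\<dots> = (\<Sum>j\<in>UNIV. (if j = t then if i = k then \<epsilon> * (x $ k - x $ t) else 0 else 0)
        + (if j = k then if i = t then \<epsilon> * (x $ t - x $ k) else 0 else 0))"
      using assms(2) by (intro sum.cong) (auto simp: doubleton_eq_iff)
    also have "\<dots> = \<epsilon> * (x $ k - x $ t) * (axis k 1 - axis t 1 :: real ^ 'a) $ i"
      using assms(2) by (simp add: sum.distrib axis_def algebra_simps)
    finally show ?thesis by simp
  qed
  then show ?thesis by (simp add: vec_eq_iff)
qed

lemma acc_edge_change:
  assumes "\<alpha> > 0" "weighted_multigraph G" "weighted_multigraph G'"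
    and "k \<noteq> t" "differs_in_edge G G' k t \<epsilon>"
  shows "acc \<alpha> G' i j - acc \<alpha> G i j = - \<alpha> * \<epsilon> * pi_diff \<alpha> G i k t * pi_diff \<alpha> G' j k t"
proof -
  let ?v = "axis k 1 - axis t 1 :: real ^ 'a"
  define x where "x = acc_matrix \<alpha> G' *v axis j 1"
  have x: "x $ i = acc \<alpha> G' i j" for i
    by (simp add: x_def acc_matrix_mult_axis)
  \<comment> \<open>\<open>x\<close> is column \<open>j\<close> of \<open>Q'\<close>; symmetry turns
    the difference of its entries \<open>k\<close> and \<open>t\<close> into one along row
    \<open>j\<close>.\<close>
  have xkt: "x $ k - x $ t = pi_diff \<alpha> G' j k t"
    by (simp add: x pi_diff_def acc_commute[OF assms(1,3), of j])
  have "axis j 1 = acc_inverse \<alpha> G' *v x"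
    using acc_matrix_right_inverse[OF assms(1,3)]
    by (simp add: x_def matrix_vector_mul_assoc)
  also have "\<dots> = acc_inverse \<alpha> G *v x + (\<alpha> * \<epsilon> * pi_diff \<alpha> G' j k t) *\<^sub>R ?v"
    by (simp add: acc_inverse_mult differs_in_edge_laplacian_mult[OF assms(5,4)] xkt
        scaleR_right_distrib mult.assoc)
  finally have "acc_matrix \<alpha> G *v axis j 1
      = x + (\<alpha> * \<epsilon> * pi_diff \<alpha> G' j k t) *\<^sub>R (acc_matrix \<alpha> G *v ?v)"
    using acc_matrix_left_inverse[OF assms(1,2)]
    by (simp add: matrix_vector_right_distrib matrix_vector_mult_scaleR matrix_vector_mul_assoc)
  then have "(acc_matrix \<alpha> G *v axis j 1) $ i
      = x $ i + \<alpha> * \<epsilon> * pi_diff \<alpha> G' j k t * (acc_matrix \<alpha> G *v ?v) $ i"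
    by simp
  then show ?thesis
    by (simp add: acc_matrix_mult_axis acc_matrix_mult_axis_diff x)
qed

theorem proposition8:
  fixes G G' :: "'n::finite wmgraph" and \<alpha> \<epsilon> :: real and k t i j :: 'n
  assumes "\<alpha> > 0"
    and "weighted_multigraph G" and "weighted_multigraph G'"
    and "k \<noteq> t" and "\<epsilon> \<noteq> 0"
    and "differs_in_edge G G' k t \<epsilon>"
  shows
    "acc \<alpha> G' i j - acc \<alpha> G i j =
       - \<alpha> * \<epsilon> * pi_diff \<alpha> G i k t * pi_diff \<alpha> G j k t * (forest_dist \<alpha> G' k t / forest_dist \<alpha> G k t) \<and>
     acc \<alpha> G' i j - acc \<alpha> G i j =
       - \<alpha> * \<epsilon> * pi_diff \<alpha> G' i k t * pi_diff \<alpha> G' j k t * (forest_dist \<alpha> G k t / forest_dist \<alpha> G' k t) \<and>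
     2 * (forest_dist \<alpha> G' i j - forest_dist \<alpha> G i j) =
       - \<alpha> * \<epsilon> * (tau \<alpha> G i k t - tau \<alpha> G j k t)^2 * (forest_dist \<alpha> G' k t / forest_dist \<alpha> G k t) \<and>
     2 * (forest_dist \<alpha> G' i j - forest_dist \<alpha> G i j) =
       - \<alpha> * \<epsilon> * (tau \<alpha> G' i k t - tau \<alpha> G' j k t)^2 * (forest_dist \<alpha> G k t / forest_dist \<alpha> G' k t) \<and>
     2 * (forest_dist \<alpha> G' i j - forest_dist \<alpha> G i j) =
       - \<alpha> * \<epsilon> * (pi_diff \<alpha> G i k t - pi_diff \<alpha> G j k t)^2 * (forest_dist \<alpha> G' k t / forest_dist \<alpha> G k t) \<and>
     2 * (forest_dist \<alpha> G' i j - forest_dist \<alpha> G i j) =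
       - \<alpha> * \<epsilon> * (pi_diff \<alpha> G' i k t - pi_diff \<alpha> G' j k t)^2 * (forest_dist \<alpha> G k t / forest_dist \<alpha> G' k t)"
proof -
  define D D' where "D = forest_dist \<alpha> G k t" and "D' = forest_dist \<alpha> G' k t"
  define p p' where "p a = pi_diff \<alpha> G a k t" and "p' a = pi_diff \<alpha> G' a k t" for a
  have D: "D > 0" and D': "D' > 0"
    using forest_dist_positive assms by (auto simp: D_def D'_def)
  have dq: "acc \<alpha> G' a b - acc \<alpha> G a b = - \<alpha> * \<epsilon> * p a * p' b" for a b
    using acc_edge_change assms by (auto simp: p_def p'_def)
  have DD: "2 * D = p k - p t" "2 * D' = p' k - p' t"
    by (simp_all add: D_def D'_def p_def p'_def two_forest_dist)
  \<comment> \<open>Subtracting \<open>dq\<close> at \<open>b = t\<close> from \<open>dq\<close> at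
    \<open>b = k\<close> leaves the factor \<open>p' k - p' t\<close>, which is
    \<open>2 * D'\<close>.\<close>
  have step: "p' a - p a = - \<alpha> * \<epsilon> * p a * (2 * D')" for a
    using dq[of a k] dq[of a t] unfolding DD(2) p_def p'_def pi_diff_def
    by (simp add: algebra_simps)
  then have p': "p' a = p a * (1 - 2 * \<alpha> * \<epsilon> * D')" for a
    by (simp add: algebra_simps)
  have "2 * D' = 2 * D * (1 - 2 * \<alpha> * \<epsilon> * D')"
    unfolding DD(1) using p'[of k] p'[of t] DD(2) by (simp add: left_diff_distrib)
  \<comment> \<open>The factor carrying \<open>p\<close> to \<open>p'\<close> also carries
    \<open>D\<close> to \<open>D'\<close>, so it is the ratio of the two distances.\<close>
  then have "D' / D = 1 - 2 * \<alpha> * \<epsilon> * D'"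
    using D by (simp add: field_simps)
  with p' have p'_eq: "p' a = p a * (D' / D)" for a by simp
  then have p_eq: "p a = p' a * (D / D')" for a using D D' by simp
  \<comment> \<open>The mixed product \<open>p a * p' b\<close> in \<open>dq\<close> is made pure by
    eliminating \<open>p'\<close> here and \<open>p\<close> in \<open>q2\<close>.\<close>
  have q1: "acc \<alpha> G' a b - acc \<alpha> G a b = - \<alpha> * \<epsilon> * p a * p b * (D' / D)" for a b
    unfolding dq p'_eq by simp
  have q2: "acc \<alpha> G' a b - acc \<alpha> G a b = - \<alpha> * \<epsilon> * p' a * p' b * (D / D')" for a b
    unfolding dq p_eq by simp
  have dd: "2 * (forest_dist \<alpha> G' i j - forest_dist \<alpha> G i j)
      = (acc \<alpha> G' i i - acc \<alpha> G i i) + (acc \<alpha> G' j j - acc \<alpha> G j j)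
        - (acc \<alpha> G' i j - acc \<alpha> G i j) - (acc \<alpha> G' j i - acc \<alpha> G j i)"
    by (simp add: forest_dist_def field_simps)
  \<comment> \<open>The products in \<open>q1\<close> combine as
    \<open>p i * p i + p j * p j - 2 * p i * p j\<close>, a perfect square; \<open>d2\<close> is the
    same with \<open>q2\<close>.\<close>
  have d1: "2 * (forest_dist \<alpha> G' i j - forest_dist \<alpha> G i j)
      = - \<alpha> * \<epsilon> * (p i - p j)\<^sup>2 * (D' / D)"
    unfolding dd q1 by (simp only: power2_eq_square) algebra
  have d2: "2 * (forest_dist \<alpha> G' i j - forest_dist \<alpha> G i j)
      = - \<alpha> * \<epsilon> * (p' i - p' j)\<^sup>2 * (D / D')"
    unfolding dd q2 by (simp only: power2_eq_square) algebra
  have t1: "(tau \<alpha> G i k t - tau \<alpha> G j k t)\<^sup>2 = (p i - p j)\<^sup>2"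
    using tau_diff[OF assms(1,2)] by (simp add: p_def power2_commute)
  have t2: "(tau \<alpha> G' i k t - tau \<alpha> G' j k t)\<^sup>2 = (p' i - p' j)\<^sup>2"
    using tau_diff[OF assms(1,3)] by (simp add: p'_def power2_commute)
  show ?thesis
    using q1[of i j] q2[of i j] d1 d2 unfolding t1 t2
    unfolding p_def p'_def D_def D'_def by blast
qed

end
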